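(* Let $x>0$, let $\sigma,\mu,\xi,\zeta,\vartheta\in\mathbb{C}$, $\eta,\nu,k\in\mathbb{R}$ and $q\in\mathbb{R}^+$, with $\Re(\sigma)>0$, $\Re(\xi)>0$, $\Re(\zeta)>0$, $\Re(\vartheta)>0$, $\eta>0$. Assume that $\frac{\xi}{k}$ and $\frac{\nu}{\eta}$ are positive real numbers and $1+\frac{\xi}{k}-q\ge 0$, and that the left-hand side below is defined and the Fox-Wright series on the right-hand side converges. Then $$\left({}^{\eta}D^{\sigma}_{0-}\,t^\mu E^{\vartheta,q}_{k,\xi,\zeta}(t^\nu)\right)(x)=(-1)^{-\sigma}\,x^{\mu-\sigma\eta}\,\frac{\eta^\sigma}{\Gamma\left(\frac{\vartheta}{k}\right)}\,k^{1-\frac{\zeta}{k}}\;{}_{2}\Psi_{2}\left[\begin{array}{c}\left(\frac{\vartheta}{k},q\right),\ \left(\frac{\mu}{\eta}+1,\frac{\nu}{\eta}\right);\\ \left(\frac{\zeta}{k},\frac{\xi}{k}\right),\ \left(\frac{\mu}{\eta}-\sigma+1,\frac{\nu}{\eta}\right);\end{array}\ k^{\,q-\frac{\xi}{k}}\,x^{\nu}\right].$$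
   Context: The $k$-gamma function is $\Gamma_k(\vartheta)=k^{\frac{\vartheta}{k}-1}\Gamma\left(\frac{\vartheta}{k}\right)$, and the $k$-Pochhammer symbol is $(\vartheta)_{nq,k}=k^{nq}\left(\frac{\vartheta}{k}\right)_{nq}$, where $(a)_{nq}=\Gamma(a+nq)/\Gamma(a)$. The generalized $k$-Mittag-Leffler function is $$E^{\vartheta,q}_{k,\xi,\zeta}(z)=\sum_{n=0}^\infty\frac{(\vartheta)_{nq,k}\,z^n}{\Gamma_k(n\xi+\zeta)\,n!},$$ for $k\in\mathbb{R}$, $\Re(\xi)>0$, $\Re(\zeta)>0$, $\Re(\vartheta)>0$, $q\in\mathbb{R}^+$. The Fox-Wright function is $${}_p\Psi_q\left[\begin{array}{c}(a_1,\xi_1),\dots,(a_p,\xi_p);\\ (b_1,\zeta_1),\dots,(b_q,\zeta_q);\end{array}\ z\right]=\sum_{n=0}^\infty\frac{\prod_{i=1}^p\Gamma(a_i+\xi_i n)}{\prod_{j=1}^q\Gamma(b_j+\zeta_j n)}\frac{z^n}{n!},$$ where $\xi_i,\zeta_j\in\mathbb{R}^+$ and $1+\sum_j\zeta_j-\sum_i\xi_i\ge0$ (here $p,q$ as subscripts of $\Psi$ are the numbers of parameter pairs). As usual $1/\Gamma$ is $0$ at the poles of $\Gamma$. For $\sigma\in\mathbb{C}$, $\Re(\sigma)>0$, $\eta>0$ and $n=[\Re(\sigma)]+1$ (with $[\cdot]$ the integer part), the operator ${}^{\eta}D^{\sigma}_{0-}$ is given by the formula $$\left({}^{\eta}D^{\sigma}_{0-}f(t)\right)(x)=\frac{\eta^{\sigma-n+1}}{\Gamma(n-\sigma)}\left(-x^{1-\eta}\frac{d}{dx}\right)^n\int_x^0\frac{t^{\eta-1}f(t)}{(t^\eta-x^\eta)^{\sigma-n+1}}\,dt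 ,$$ used here at $x>0$, with $\int_x^0=-\int_0^x$ (oriented integral) and complex powers of negative real numbers taken with the principal branch, $(-a)^c=e^{i\pi c}a^c$ for $a>0$; in particular $(-1)^{-\sigma}=e^{-i\pi\sigma}$. It is defined when $f$ is defined on $(0,b)$ for some $b>x$ (in particular any series defining $f$ converges there), the integral converges absolutely for all lower limits near $x$, and the indicated derivatives exist at $x$. Here $f(t)=t^\mu E^{\vartheta,q}_{k,\xi,\zeta}(t^\nu)$. *)

theory Defs
  imports "HOL-Analysis.Analysis"
begin

text \<open>
  All complex powers are principal (library powr). The library's Gamma takes the value 0 at
  its poles, so a quotient with Gamma in the denominator is 0 there, in accordance with the
  usual convention for 1/Gamma.
\<close>

definition k_Gamma :: "real \<Rightarrow> complex \<Rightarrow> complex" where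
  "k_Gamma k \<theta> = of_real k powr (\<theta> / of_real k - 1) * Gamma (\<theta> / of_real k)"

definition gen_pochhammer :: "complex \<Rightarrow> real \<Rightarrow> complex" where
  "gen_pochhammer a s = Gamma (a + of_real s) / Gamma a"

definition k_pochhammer :: "real \<Rightarrow> complex \<Rightarrow> real \<Rightarrow> complex" where
  "k_pochhammer k \<theta> s = of_real k powr of_real s * gen_pochhammer (\<theta> / of_real k) s"

definition k_mittag_leffler_term ::
    "complex \<Rightarrow> real \<Rightarrow> real \<Rightarrow> complex \<Rightarrow> complex \<Rightarrow> complex \<Rightarrow> nat \<Rightarrow> complex" where
  "k_mittag_leffler_term \<theta> q k \<xi> \<zeta> z n =
     k_pochhammer k \<theta> (of_nat n * q) * z ^ n / (k_Gamma k (of_nat n * \<xi> + \<zeta>) * fact n)"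

definition k_mittag_leffler ::
    "complex \<Rightarrow> real \<Rightarrow> real \<Rightarrow> complex \<Rightarrow> complex \<Rightarrow> complex \<Rightarrow> complex" where
  "k_mittag_leffler \<theta> q k \<xi> \<zeta> z = (\<Sum>n. k_mittag_leffler_term \<theta> q k \<xi> \<zeta> z n)"

text \<open>
  The Fox--Wright function takes its parameter pairs as two lists; their lengths are the
  indices p and q of the usual notation.
\<close>

definition fox_wright_term ::
    "(complex \<times> real) list \<Rightarrow> (complex \<times> real) list \<Rightarrow> complex \<Rightarrow> nat \<Rightarrow> complex" where
  "fox_wright_term as bs z n =
     (\<Prod>(a, \<alpha>)\<leftarrow>as. Gamma (a + of_real \<alpha> * of_nat n)) /
     (\<Prod>(b, \<beta>)\<leftarrow>bs. Gamma (b + of_real \<beta> * of_nat n)) * (z ^ n / fact n)"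

definition fox_wright ::
    "(complex \<times> real) list \<Rightarrow> (complex \<times> real) list \<Rightarrow> complex \<Rightarrow> complex" where
  "fox_wright as bs z = (\<Sum>n. fox_wright_term as bs z n)"

text \<open>The terms of the series are meaningful only if no numerator Gamma is taken at a pole.\<close>

definition fox_wright_converges ::
    "(complex \<times> real) list \<Rightarrow> (complex \<times> real) list \<Rightarrow> complex \<Rightarrow> bool" where
  "fox_wright_converges as bs z \<longleftrightarrow>
     (\<forall>(a, \<alpha>)\<in>set as. \<forall>n::nat. a + of_real \<alpha> * of_nat n \<notin> \<int>\<^sub>\<le>\<^sub>0) \<and>
     summable (fox_wright_term as bs z)"

definition frac_order :: "complex \<Rightarrow> nat" where
  "frac_order \<sigma> = nat \<lfloor>Re \<sigma>\<rfloor> + 1"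

definition frac_kernel ::
    "real \<Rightarrow> complex \<Rightarrow> (real \<Rightarrow> complex) \<Rightarrow> real \<Rightarrow> real \<Rightarrow> complex" where
  "frac_kernel \<eta> \<sigma> f x t =
     of_real (t powr (\<eta> - 1)) * f t /
     of_real (t powr \<eta> - x powr \<eta>) powr (\<sigma> - of_nat (frac_order \<sigma>) + 1)"

text \<open>The oriented integral from x to 0; for positive x it is minus the integral over (0,x).\<close>

definition frac_integral :: "real \<Rightarrow> complex \<Rightarrow> (real \<Rightarrow> complex) \<Rightarrow> real \<Rightarrow> complex" where
  "frac_integral \<eta> \<sigma> f x = (LBINT t=ereal x..0. frac_kernel \<eta> \<sigma> f x t)"

definition weighted_deriv :: "real \<Rightarrow> (real \<Rightarrow> complex) \<Rightarrow> real \<Rightarrow> complex" where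
  "weighted_deriv \<eta> g x = - of_real (x powr (1 - \<eta>)) * vector_derivative g (at x)"

fun weighted_deriv_exists :: "real \<Rightarrow> nat \<Rightarrow> (real \<Rightarrow> complex) \<Rightarrow> real \<Rightarrow> bool" where
  "weighted_deriv_exists \<eta> 0 g x \<longleftrightarrow> True"
| "weighted_deriv_exists \<eta> (Suc m) g x \<longleftrightarrow>
     (\<forall>\<^sub>F y in nhds x. weighted_deriv_exists \<eta> m g y) \<and>
     (weighted_deriv \<eta> ^^ m) g differentiable (at x)"

definition frac_deriv :: "real \<Rightarrow> complex \<Rightarrow> (real \<Rightarrow> complex) \<Rightarrow> real \<Rightarrow> complex" where
  "frac_deriv \<eta> \<sigma> f x =
     of_real \<eta> powr (\<sigma> - of_nat (frac_order \<sigma>) + 1) / Gamma (of_nat (frac_order \<sigma>) - \<sigma>) *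
     (weighted_deriv \<eta> ^^ frac_order \<sigma>) (frac_integral \<eta> \<sigma> f) x"

text \<open>
  Since f is a total function here, the set S on which it is properly defined is a separate
  argument.
\<close>

definition frac_deriv_defined ::
    "real \<Rightarrow> complex \<Rightarrow> real set \<Rightarrow> (real \<Rightarrow> complex) \<Rightarrow> real \<Rightarrow> bool" where
  "frac_deriv_defined \<eta> \<sigma> S f x \<longleftrightarrow>
     (\<exists>b>x. {0<..<b} \<subseteq> S) \<and>
     (\<forall>\<^sub>F y in nhds x. interval_lebesgue_integrable lborel (ereal y) 0 (frac_kernel \<eta> \<sigma> f y)) \<and>
     weighted_deriv_exists \<eta> (frac_order \<sigma>) (frac_integral \<eta> \<sigma> f) x"

end

theory Submission
  imports Defs
begin

text \<open>
  For a single power \<open>t\<close> to the \<open>p\<close> the formula is a computation. The substitution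
  \<open>u = (t / y) powr \<eta>\<close> turns the fractional integral into Euler's Beta integral with complex parameters,
  giving a multiple of \<open>y\<close> to the power \<open>p + \<eta> (N - \<sigma>)\<close>, where \<open>N\<close> is the order of the derivative;
  then \<open>N\<close> weighted derivatives bring down a Pochhammer factor that cancels \<open>N\<close> steps of
  \<open>\<Gamma>\<close>, leaving \<open>\<Gamma>(p/\<eta> + 1) / \<Gamma>(p/\<eta> + 1 - \<sigma>)\<close>. Summed over the exponents \<open>p = \<mu> + n\<nu>\<close> with the
  coefficients of the k-Mittag-Leffler series this is the Fox--Wright series, term by term; the phase of the
  negative base in the kernel becomes the factor \<open>exp (-i\<pi>\<sigma>)\<close>.

  The work lies in justifying the termwise operations, and both needed facts are contained in the assumption
  that the left-hand side is defined. Firstly, the series converges on \<open>(0, R)\<close> for some \<open>R > x\<close>, so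
  as a power series in \<open>y powr \<nu>\<close> it converges absolutely near \<open>x\<close>, even when its radius of
  convergence is finite. This permits termwise integration
  (\<open>Beta_integral_power_series\<close>) and differentiation (\<open>weighted_deriv_funpow_power_series\<close>), which are
  combined in \<open>frac_deriv_power_series\<close>. Secondly, the kernel is absolutely integrable at \<open>0\<close>, where it
  behaves like a nonzero multiple of \<open>t\<close> to the power \<open>\<mu> + \<eta> - 1\<close>, since the constant coefficient of
  the series is nonzero. Hence \<open>\<mu>/\<eta> + 1\<close> has positive real part
  (\<open>frac_kernel_integrable_imp_exponent_gt\<close>), which is exactly what the Beta integrals require.

  The Beta integral itself (\<open>Beta_integral_complex\<close>) comes from computing the total integral of the
  convolution of two Gamma densities in two ways.
\<close>

section \<open>Euler's Beta integral for complex parameters\<close>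

lemma of_real_powr_eq_exp:
  "0 < t \<Longrightarrow> complex_of_real t powr c = exp (c * of_real (ln t))"
  by (simp add: powr_def Ln_of_real)

lemma measurable_of_real_powr [measurable]:
  assumes [measurable]: "f \<in> borel_measurable M"
  shows "(\<lambda>x. complex_of_real (f x) powr c) \<in> borel_measurable M"
proof -
  have "complex_of_real t powr c =
     (if 0 < t then exp (c * of_real (ln t)) else if t = 0 then 0
      else exp (c * (of_real (ln (- t)) + \<i> * of_real pi)))" for t
    using Ln_of_real[of "-t"] by (auto simp: powr_def Ln_of_real Ln_minus[of "complex_of_real (-t)", simplified])
  thus ?thesis by simp
qed

lemma Gamma_neq_0_if_Re_pos: "0 < Re z \<Longrightarrow> Gamma z \<noteq> (0 :: complex)"
  by (auto simp: Gamma_eq_zero_iff elim!: nonpos_Ints_cases')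

text \<open>
  The integrand of Euler's integral for \<open>\<Gamma>(c)\<close>, cut off to a function on the whole line so that
  two of them can be convolved.
\<close>

definition gamma_kernel :: "complex \<Rightarrow> real \<Rightarrow> complex" where
  "gamma_kernel c v = indicator {0<..} v *\<^sub>R (of_real v powr (c - 1) / of_real (exp v))"

lemma measurable_gamma_kernel [measurable]: "gamma_kernel c \<in> borel_measurable borel"
  unfolding gamma_kernel_def by measurable

lemma has_bochner_integral_gamma_kernel:
  assumes "0 < Re c"
  shows "has_bochner_integral lborel (gamma_kernel c) (Gamma c)"
proof -
  have *: "set_integrable lborel {0<..} (\<lambda>t. complex_of_real t powr (c - 1) / of_real (exp t))"
    using absolutely_integrable_Gamma_integral'[OF assms] unfolding set_integrable_def
    by (subst (asm) integrable_completion) simp_all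
  have "set_lebesgue_integral lborel {0<..} (\<lambda>t. complex_of_real t powr (c - 1) / of_real (exp t)) = Gamma c"
    using set_borel_integral_eq_integral(2)[OF *] Gamma_integral_complex'[OF assms] by (simp add: integral_unique)
  with * show ?thesis
    by (simp add: has_bochner_integral_iff set_integrable_def set_lebesgue_integral_def gamma_kernel_def [abs_def])
qed

text \<open>
  The convolution of the kernels for \<open>a\<close> and \<open>b\<close> at \<open>u > 0\<close> is, after scaling the variable by \<open>u\<close>,
  the kernel for \<open>a + b\<close> times the Beta integral. Integrating over the plane in both orders gives
  \<open>\<Gamma>(a + b)\<close> times the Beta integral on one side and \<open>\<Gamma>(a) \<Gamma>(b)\<close> on the other.
\<close>

lemma Beta_integral_complex:
  assumes a: "0 < Re a" and b: "0 < Re b"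
  shows "set_integrable lborel {0<..<1} (\<lambda>t. complex_of_real t powr (a - 1) * of_real (1 - t) powr (b - 1))"
    and "(LINT t:{0<..<1}|lborel. complex_of_real t powr (a - 1) * of_real (1 - t) powr (b - 1)) = Beta a b"
proof -
  define \<beta> where "\<beta> t = indicator {0<..<1} t *\<^sub>R (complex_of_real t powr (a - 1) * of_real (1 - t) powr (b - 1))" for t :: real
  have "set_integrable lborel {0<..<1} (\<lambda>t. t powr (Re a - 1) * (1 - t) powr (Re b - 1))"
    by (rule set_integrable_subset[OF integrable_Beta[OF a b]]) auto
  then show int: "set_integrable lborel {0<..<1}
      (\<lambda>t. complex_of_real t powr (a - 1) * of_real (1 - t) powr (b - 1))"
    unfolding set_integrable_def
  proof (rule Bochner_Integration.integrable_bound)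
    show "(\<lambda>t. indicat_real {0<..<1} t *\<^sub>R (complex_of_real t powr (a - 1) * of_real (1 - t) powr (b - 1)))
        \<in> borel_measurable lborel"
      by measurable
  qed (auto simp: indicator_def norm_mult norm_powr_real_powr simp del: of_real_diff)
  define f where "f s u = gamma_kernel a s * gamma_kernel b (u - s)" for s u
  have Gb: "has_bochner_integral lborel (\<lambda>u. gamma_kernel b (u - s)) (Gamma b)" for s
    using has_bochner_integral_gamma_kernel[OF b] lborel_integral_real_affine[of 1 "gamma_kernel b" "-s"]
      lborel_integrable_real_affine[of "gamma_kernel b" 1 "-s"]
    by (simp add: has_bochner_integral_iff)
  have normGb: "(\<integral>u. norm (gamma_kernel b (u - s)) \<partial>lborel) = (\<integral>u. norm (gamma_kernel b u) \<partial>lborel)" for s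
    using lborel_integral_real_affine[of 1 "\<lambda>u. norm (gamma_kernel b u)" "-s"] by simp
  have [measurable]: "case_prod f \<in> borel_measurable (lborel \<Otimes>\<^sub>M lborel)"
    unfolding f_def case_prod_unfold by measurable
  have "integrable (lborel \<Otimes>\<^sub>M lborel) (case_prod f)"
  proof (rule lborel_pair.Fubini_integrable)
    have "(\<lambda>s. \<integral>u. norm (case_prod f (s, u)) \<partial>lborel) =
        (\<lambda>s. norm (gamma_kernel a s) * (\<integral>u. norm (gamma_kernel b u) \<partial>lborel))"
      by (simp add: f_def norm_mult normGb)
    moreover have "integrable lborel (\<lambda>s. norm (gamma_kernel a s))"
      using has_bochner_integral_gamma_kernel[OF a] by (auto simp: has_bochner_integral_iff)
    ultimately show "integrable lborel (\<lambda>s. \<integral>u. norm (case_prod f (s, u)) \<partial>lborel)"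
      by simp
    show "AE s in lborel. integrable lborel (\<lambda>u. case_prod f (s, u))"
      using Gb by (auto simp: f_def has_bochner_integral_iff)
  qed simp
  then have "(\<integral>u. (\<integral>s. f s u \<partial>lborel) \<partial>lborel) = (\<integral>s. (\<integral>u. f s u \<partial>lborel) \<partial>lborel)"
    by (rule lborel_pair.Fubini_integral)
  also have "\<dots> = Gamma a * Gamma b"
    using Gb has_bochner_integral_gamma_kernel[OF a] by (simp add: f_def has_bochner_integral_iff)
  also have "(\<lambda>u. \<integral>s. f s u \<partial>lborel) = (\<lambda>u. gamma_kernel (a + b) u * integral\<^sup>L lborel \<beta>)"
  proof
    fix u :: real
    show "(\<integral>s. f s u \<partial>lborel) = gamma_kernel (a + b) u * integral\<^sup>L lborel \<beta>"
    proof (cases "0 < u")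
      case True
      \<comment> \<open>the scaling \<open>s = u v\<close> separates the variables\<close>
      have "u *\<^sub>R f (u * v) u = gamma_kernel (a + b) u * \<beta> v" for v
      proof (cases "0 < v \<and> v < 1")
        case v: True
        have "u - u * v = u * (1 - v)" by (simp add: algebra_simps)
        moreover have "0 < u * v" "0 < u * (1 - v)" using v True by auto
        moreover have "exp u = exp (u * v) * exp (u * (1 - v))"
          by (simp flip: exp_add add: algebra_simps)
        moreover have "complex_of_real u powr (a + b - 1) = u * of_real u powr (a - 1) * of_real u powr (b - 1)"
          using True by (simp add: powr_diff powr_add)
        ultimately show ?thesis using v True
          by (simp add: f_def gamma_kernel_def \<beta>_def powr_times_real scaleR_conv_of_real del: of_real_diff)
      next
        case False
        then have "\<not> 0 < u * v \<or> \<not> 0 < u - u * v"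
          using True by (auto simp: zero_less_mult_iff)
        then show ?thesis using False by (auto simp: f_def gamma_kernel_def \<beta>_def indicator_def)
      qed
      then show ?thesis
        using True lborel_integral_real_affine[of u "\<lambda>s. f s u" 0] by (simp flip: integral_scaleR_right)
    next
      case False
      then have "f s u = 0" for s by (auto simp: f_def gamma_kernel_def indicator_def)
      with False show ?thesis by (simp add: gamma_kernel_def)
    qed
  qed
  also have "(\<integral>u. gamma_kernel (a + b) u * integral\<^sup>L lborel \<beta> \<partial>lborel) = Gamma (a + b) * integral\<^sup>L lborel \<beta>"
    using has_bochner_integral_gamma_kernel[of "a + b"] a b by (simp add: has_bochner_integral_iff)
  finally have "Gamma (a + b) * integral\<^sup>L lborel \<beta> = Gamma a * Gamma b" .
  moreover have "Gamma (a + b) \<noteq> 0"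
    using a b by (intro Gamma_neq_0_if_Re_pos) simp
  ultimately show "(LINT t:{0<..<1}|lborel. complex_of_real t powr (a - 1) * of_real (1 - t) powr (b - 1)) = Beta a b"
    by (simp add: Beta_def set_lebesgue_integral_def \<beta>_def[abs_def] field_simps)
qed

section \<open>The integral transform of powers and of power series\<close>

text \<open>
  The substitution \<open>u = (t / y) powr \<eta>\<close> maps \<open>(0, y)\<close> onto \<open>(0, 1)\<close> and turns the integrand into
  that of the Beta integral with parameters \<open>s / \<eta> + 1\<close> and \<open>b\<close>.
\<close>

lemma Beta_integral_rescaled:
  fixes y \<eta> :: real and s b :: complex
  assumes y: "0 < y" and \<eta>: "0 < \<eta>" and s: "0 < Re (s / \<eta> + 1)" and b: "0 < Re b"
  defines "K \<equiv> \<lambda>t. of_real (t powr (\<eta> - 1)) * of_real t powr s * of_real (y powr \<eta> - t powr \<eta>) powr (b - 1)"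
  shows "set_integrable lborel {0<..<y} K"
    and "(LINT t:{0<..<y}|lborel. K t) = of_real y powr (s + \<eta> * b) / \<eta> * Beta (s / \<eta> + 1) b"
proof -
  define f where "f u = complex_of_real u powr (s / \<eta> + 1 - 1) * of_real (1 - u) powr (b - 1)" for u :: real
  define g h where "g t = (t / y) powr \<eta>" and "h t = \<eta> / y * (t / y) powr (\<eta> - 1)" for t
  define C where "C = complex_of_real y powr (s + \<eta> * b) / \<eta>"
  have f: "set_integrable lborel {0<..<1} f" "(LINT t:{0<..<1}|lborel. f t) = Beta (s / \<eta> + 1) b"
    unfolding f_def using Beta_integral_complex[OF s b] by simp_all
  have "f absolutely_integrable_on {0<..<1}"
    using f(1) unfolding set_integrable_def
    by (subst integrable_completion) (auto dest: borel_measurable_integrable)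
  moreover have "integral {0<..<1} f = Beta (s / \<eta> + 1) b"
    using set_borel_integral_eq_integral(2)[OF f(1)] f(2) by simp
  moreover have "g ` {0<..<y} = {0<..<1}"
  proof (intro equalityI subsetI)
    fix u assume u: "u \<in> {0<..<1::real}"
    have "u powr (1 / \<eta>) < 1 powr (1 / \<eta>)"
      using u \<eta> by (intro powr_less_mono2) auto
    moreover have "g (y * u powr (1 / \<eta>)) = u"
      using y u \<eta> by (simp add: g_def powr_powr)
    ultimately show "u \<in> g ` {0<..<y}" using y u by (intro image_eqI[of _ _ "y * u powr (1 / \<eta>)"]) auto
  next
    fix u assume "u \<in> g ` {0<..<y}"
    then obtain t where t: "0 < t" "t < y" "u = (t / y) powr \<eta>" by (auto simp: g_def)
    have "(t / y) powr \<eta> < 1 powr \<eta>"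
      using t y \<eta> by (intro powr_less_mono2) auto
    with t y show "u \<in> {0<..<1}" by simp
  qed
  moreover have "(g has_field_derivative h t) (at t within {0<..<y})" if "t \<in> {0<..<y}" for t
    unfolding g_def h_def using that y
    by (auto intro!: derivative_eq_intros simp: powr_diff field_simps)
  moreover have "inj_on g {0<..<y}"
    unfolding g_def using y \<eta>
    by (intro inj_on_inverseI[where g = "\<lambda>u. y * u powr (1 / \<eta>)"]) (auto simp: powr_powr)
  ultimately have hf: "(\<lambda>t. \<bar>h t\<bar> *\<^sub>R f (g t)) absolutely_integrable_on {0<..<y}"
      "integral {0<..<y} (\<lambda>t. \<bar>h t\<bar> *\<^sub>R f (g t)) = Beta (s / \<eta> + 1) b"
    using has_absolute_integral_change_of_variables_real[of "{0<..<y}" g h f "Beta (s / \<eta> + 1) b"] by auto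
  \<comment> \<open>homogeneity: with \<open>t = y r\<close> every factor splits into a power of \<open>y\<close>, collected in \<open>C\<close>, and a power of \<open>r\<close>\<close>
  have K: "K t = C * (\<bar>h t\<bar> *\<^sub>R f (g t))" if t: "t \<in> {0<..<y}" for t
  proof -
    define r where "r = t / y"
    have r: "0 < r" "r < 1" "t = y * r" using t y by (auto simp: r_def)
    have "r powr \<eta> < 1 powr \<eta>" using r \<eta> by (intro powr_less_mono2) auto
    then have *: "0 < 1 - r powr \<eta>" by simp
    have 1: "complex_of_real (t powr (\<eta> - 1)) = of_real (y powr (\<eta> - 1)) * of_real (r powr (\<eta> - 1))"
      using r y by (simp add: powr_mult)
    have 2: "complex_of_real t powr s = of_real y powr s * of_real r powr s"
      using r y by (simp add: powr_times_real)
    have "y powr \<eta> - t powr \<eta> = y powr \<eta> * (1 - r powr \<eta>)"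
      using r y by (simp add: powr_mult algebra_simps)
    then have 3: "complex_of_real (y powr \<eta> - t powr \<eta>) powr (b - 1) =
        of_real (y powr \<eta>) powr (b - 1) * of_real (1 - r powr \<eta>) powr (b - 1)"
      using r y * by (simp add: powr_times_real del: of_real_diff)
    have 4: "complex_of_real (r powr \<eta>) powr (s / \<eta>) = of_real r powr s"
      using r \<eta> by (simp add: of_real_powr_eq_exp ln_powr)
    have 5: "of_real (y powr (\<eta> - 1)) * of_real y powr s * complex_of_real (y powr \<eta>) powr (b - 1) = C * (\<eta> / y)"
    proof -
      have "complex_of_real (y powr (\<eta> - 1)) = exp (of_real ((\<eta> - 1) * ln y))"
        using y by (simp add: powr_def flip: exp_of_real)
      then have "of_real (y powr (\<eta> - 1)) * of_real y powr s * complex_of_real (y powr \<eta>) powr (b - 1) =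
          of_real y powr (s + \<eta> * b - 1)"
        using y by (simp add: of_real_powr_eq_exp ln_powr algebra_simps flip: exp_add)
      then show ?thesis using y \<eta> by (simp add: C_def powr_diff)
    qed
    have "K t = of_real (y powr (\<eta> - 1)) * of_real y powr s * complex_of_real (y powr \<eta>) powr (b - 1)
        * (of_real (r powr (\<eta> - 1)) * (of_real r powr s * of_real (1 - r powr \<eta>) powr (b - 1)))"
      unfolding K_def 1 2 3 by (simp only: mult_ac)
    also have "\<dots> = C * (\<bar>h t\<bar> *\<^sub>R f (g t))"
      unfolding 5 using y \<eta> r(1)
      by (simp add: h_def g_def f_def 4 scaleR_conv_of_real mult_ac flip: r_def del: of_real_diff)
    finally show ?thesis .
  qed
  have "K absolutely_integrable_on {0<..<y}"
    using set_integrable_mult_right[of C, OF hf(1)] K by (subst set_integrable_cong[OF refl refl K]) auto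
  then show int: "set_integrable lborel {0<..<y} K"
    unfolding set_integrable_def K_def by (subst (asm) integrable_completion) (auto simp del: of_real_diff)
  have "(LINT t:{0<..<y}|lborel. K t) = integral {0<..<y} K"
    using set_borel_integral_eq_integral(2)[OF int] .
  also have "\<dots> = integral {0<..<y} (\<lambda>t. C * (\<bar>h t\<bar> *\<^sub>R f (g t)))"
    by (rule integral_cong) (rule K)
  also have "\<dots> = C * Beta (s / \<eta> + 1) b"
    by (simp only: integral_mult_right hf(2))
  finally show "(LINT t:{0<..<y}|lborel. K t) = of_real y powr (s + \<eta> * b) / \<eta> * Beta (s / \<eta> + 1) b"
    by (simp add: C_def)
qed

text \<open>
  Termwise integration: on \<open>(0, y)\<close> the \<open>n\<close>-th term is bounded by \<open>|c\<^sub>n| y\<^bsup>\<nu>n\<^esup>\<close> times the fixed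
  integrable function obtained from the power \<open>\<mu>\<close> alone, so the integrals of the norms are summable.
\<close>

lemma Beta_integral_power_series:
  fixes y \<eta> \<nu> :: real and \<mu> b :: complex and c :: "nat \<Rightarrow> complex"
  assumes y: "0 < y" and \<eta>: "0 < \<eta>" and \<nu>: "0 < \<nu>" and \<mu>: "0 < Re (\<mu> / \<eta> + 1)" and b: "0 < Re b"
    and c: "summable (\<lambda>n. norm (c n) * (y powr \<nu>) ^ n)"
  shows "(\<lambda>n. of_real y powr (\<mu> + \<eta> * b) / \<eta> * (c n * Beta ((\<mu> + of_nat n * of_real \<nu>) / \<eta> + 1) b * of_real (y powr \<nu>) ^ n))
     sums (LINT t:{0<..<y}|lborel. of_real (t powr (\<eta> - 1)) *
          (of_real t powr \<mu> * (\<Sum>n. c n * of_real (t powr \<nu>) ^ n)) * of_real (y powr \<eta> - t powr \<eta>) powr (b - 1))"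
proof -
  define K where "K s t = of_real (t powr (\<eta> - 1)) * of_real t powr s * of_real (y powr \<eta> - t powr \<eta>) powr (b - 1)"
    for s :: complex and t :: real
  define F where "F n t = indicator {0<..<y} t *\<^sub>R (c n * K (\<mu> + of_nat n * of_real \<nu>) t)" for n t
  define k where "k t = norm (indicator {0<..<y} t *\<^sub>R K \<mu> t)" for t
  have s: "0 < Re ((\<mu> + of_nat n * of_real \<nu>) / \<eta> + 1)" for n
  proof -
    have "Re ((\<mu> + of_nat n * of_real \<nu>) / \<eta> + 1) = Re (\<mu> / \<eta> + 1) + n * \<nu> / \<eta>"
      by (simp add: add_divide_distrib)
    also have "\<dots> > 0" using \<mu> \<nu> \<eta> by (intro add_pos_nonneg) auto
    finally show ?thesis .
  qed
  note I = Beta_integral_rescaled[OF y \<eta> s b, folded K_def]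
  have intK: "integrable lborel (\<lambda>t. indicator {0<..<y} t *\<^sub>R K (\<mu> + of_nat n * of_real \<nu>) t)" for n
    using I(1)[of n] by (simp add: set_integrable_def)
  have intF: "integrable lborel (F n)" for n
    using integrable_mult_right[OF intK[of n], of "c n"] by (simp add: F_def [abs_def])
  have intk: "integrable lborel k"
    using integrable_norm[OF intK[of 0]] by (simp add: k_def [abs_def])
  have K_shift: "K (\<mu> + of_nat n * of_real \<nu>) t = K \<mu> t * of_real (t powr \<nu>) ^ n" if "0 < t" for n t
    using that by (simp add: K_def powr_add of_real_powr_eq_exp powr_def[of t] exp_of_nat_mult mult_ac flip: exp_of_real)
  have bound: "norm (F n t) \<le> norm (c n) * (y powr \<nu>) ^ n * k t" for n t
  proof (cases "t \<in> {0<..<y}")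
    case True
    then have "(t powr \<nu>) ^ n \<le> (y powr \<nu>) ^ n"
      using \<nu> by (intro power_mono powr_mono2) auto
    then have "norm (c n) * norm (K \<mu> t) * (t powr \<nu>) ^ n \<le> norm (c n) * norm (K \<mu> t) * (y powr \<nu>) ^ n"
      by (intro mult_left_mono) auto
    with True show ?thesis by (simp add: F_def k_def K_shift norm_mult norm_power mult_ac)
  qed (simp add: F_def k_def)
  have "(\<lambda>n. integral\<^sup>L lborel (F n)) sums (\<integral>t. (\<Sum>n. F n t) \<partial>lborel)"
  proof (rule sums_integral)
    show "integrable lborel (F n)" for n by (rule intF)
    show "AE t in lborel. summable (\<lambda>n. norm (F n t))"
      by (intro AE_I2 summable_comparison_test'[OF summable_mult2[OF c], of 0]) (use bound in auto)
    show "summable (\<lambda>n. \<integral>t. norm (F n t) \<partial>lborel)"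
    proof (rule summable_comparison_test'[OF summable_mult2[OF c, of "integral\<^sup>L lborel k"], of 0])
      fix n
      have "(\<integral>t. norm (F n t) \<partial>lborel) \<le> (\<integral>t. norm (c n) * (y powr \<nu>) ^ n * k t \<partial>lborel)"
        using intF intk bound by (intro integral_mono) auto
      then show "norm (\<integral>t. norm (F n t) \<partial>lborel) \<le> norm (c n) * (y powr \<nu>) ^ n * integral\<^sup>L lborel k"
        by simp
    qed
  qed
  moreover have "integral\<^sup>L lborel (F n) =
      of_real y powr (\<mu> + \<eta> * b) / \<eta> * (c n * Beta ((\<mu> + of_nat n * of_real \<nu>) / \<eta> + 1) b * of_real (y powr \<nu>) ^ n)" for n
  proof -
    have "integral\<^sup>L lborel (F n) = c n * (LINT t:{0<..<y}|lborel. K (\<mu> + of_nat n * of_real \<nu>) t)"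
      by (simp add: F_def [abs_def] set_lebesgue_integral_def flip: integral_mult_right_zero)
    also have "(LINT t:{0<..<y}|lborel. K (\<mu> + of_nat n * of_real \<nu>) t) =
        of_real y powr (\<mu> + of_nat n * of_real \<nu> + \<eta> * b) / \<eta> * Beta ((\<mu> + of_nat n * of_real \<nu>) / \<eta> + 1) b"
      by (rule I(2))
    also have "complex_of_real y powr (\<mu> + of_nat n * of_real \<nu> + \<eta> * b) = of_real y powr (\<mu> + \<eta> * b) * of_real (y powr \<nu>) ^ n"
      using y by (simp add: powr_def[of y] of_real_powr_eq_exp algebra_simps exp_add exp_of_nat_mult flip: exp_of_real)
    finally show ?thesis by (simp add: mult_ac)
  qed
  moreover have "(\<integral>t. (\<Sum>n. F n t) \<partial>lborel) = (LINT t:{0<..<y}|lborel. of_real (t powr (\<eta> - 1)) *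
          (of_real t powr \<mu> * (\<Sum>n. c n * of_real (t powr \<nu>) ^ n)) * of_real (y powr \<eta> - t powr \<eta>) powr (b - 1))"
    unfolding set_lebesgue_integral_def
  proof (intro Bochner_Integration.integral_cong refl)
    fix t
    show "(\<Sum>n. F n t) = indicator {0<..<y} t *\<^sub>R (of_real (t powr (\<eta> - 1)) *
          (of_real t powr \<mu> * (\<Sum>n. c n * of_real (t powr \<nu>) ^ n)) * of_real (y powr \<eta> - t powr \<eta>) powr (b - 1))"
    proof (cases "t \<in> {0<..<y}")
      case True
      then have "(t powr \<nu>) ^ n \<le> (y powr \<nu>) ^ n" for n
        using \<nu> by (intro power_mono powr_mono2) auto
      then have "summable (\<lambda>n. c n * complex_of_real (t powr \<nu>) ^ n)"
        by (intro summable_comparison_test'[OF c, of 0]) (simp add: norm_mult norm_power mult_left_mono)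
      then have "(\<Sum>n. K \<mu> t * (c n * complex_of_real (t powr \<nu>) ^ n)) = K \<mu> t * (\<Sum>n. c n * of_real (t powr \<nu>) ^ n)"
        by (rule suminf_mult)
      with True show ?thesis
        by (simp add: F_def K_shift mult_ac) (simp add: K_def mult_ac)
    qed (simp add: F_def)
  qed
  ultimately show ?thesis by simp
qed

section \<open>Iterating the weighted derivative on a power series\<close>

text \<open>
  The exponent of the \<open>n\<close>-th term is \<open>s + n\<nu>\<close>. Termwise differentiation is allowed because convergence
  on all of \<open>(0, R)\<close> puts every \<open>y powr \<nu>\<close> strictly inside the disc of convergence; the
  conclusion has the shape of the hypothesis again, which permits iteration.
\<close>

lemma powr_power_series_has_vector_derivative:
  fixes d :: "nat \<Rightarrow> complex" and s :: complex and \<nu> R y :: real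
  assumes \<nu>: "0 < \<nu>" and y: "0 < y" "y < R"
    and d: "\<And>y. 0 < y \<Longrightarrow> y < R \<Longrightarrow> summable (\<lambda>n. d n * of_real (y powr \<nu>) ^ n)"
  shows "summable (\<lambda>n. (s + of_nat n * of_real \<nu>) * d n * of_real (y powr \<nu>) ^ n)"
    and "((\<lambda>y. of_real y powr s * (\<Sum>n. d n * of_real (y powr \<nu>) ^ n)) has_vector_derivative
      of_real y powr (s - 1) * (\<Sum>n. (s + of_nat n * of_real \<nu>) * d n * of_real (y powr \<nu>) ^ n)) (at y)"
proof -
  define w where "w = complex_of_real (y powr \<nu>)"
  \<comment> \<open>a point beyond \<open>y\<close> at which the series still converges\<close>
  define z where "z = (y + R) / 2"
  have z: "0 < z" "y < z" "z < R" using y by (auto simp: z_def)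
  have sz: "summable (\<lambda>n. d n * of_real (z powr \<nu>) ^ n)" using z by (intro d)
  have w: "norm w < norm (complex_of_real (z powr \<nu>))"
    using y z \<nu> by (simp add: w_def powr_less_mono2)
  have sd: "summable (\<lambda>n. d n * w ^ n)"
    using y by (simp add: w_def d)
  have "summable (\<lambda>n. diffs d n * w ^ n)"
    by (rule termdiff_converges[of w "norm (complex_of_real (z powr \<nu>))"], rule w) (rule powser_inside[OF sz], simp)
  from diffs_equiv[OF this] have "(\<lambda>n. w * (of_nat n * d n * w ^ (n - Suc 0))) sums (w * (\<Sum>n. diffs d n * w ^ n))"
    by (rule sums_mult)
  moreover have "w * (of_nat n * d n * w ^ (n - Suc 0)) = of_nat n * d n * w ^ n" for n
    by (cases n) auto
  ultimately have S: "(\<lambda>n. of_nat n * d n * w ^ n) sums (w * (\<Sum>n. diffs d n * w ^ n))" by simp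
  have T: "(\<lambda>n. (s + of_nat n * of_real \<nu>) * d n * w ^ n) sums
      (s * (\<Sum>n. d n * w ^ n) + of_real \<nu> * (w * (\<Sum>n. diffs d n * w ^ n)))"
    using sums_add[OF sums_mult[OF summable_sums[OF sd], of s] sums_mult[OF S, of "of_real \<nu>"]]
    by (simp add: algebra_simps)
  then show "summable (\<lambda>n. (s + of_nat n * of_real \<nu>) * d n * of_real (y powr \<nu>) ^ n)"
    by (auto simp: w_def sums_iff)
  have "((\<lambda>w. \<Sum>n. d n * w ^ n) has_field_derivative (\<Sum>n. diffs d n * w ^ n)) (at w)"
    by (rule termdiffs_strong[OF sz w])
  moreover have "((\<lambda>y. complex_of_real (y powr \<nu>)) has_vector_derivative of_real (\<nu> * y powr (\<nu> - 1))) (at y)"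
    using y by (intro has_vector_derivative_of_real) (auto intro!: derivative_eq_intros simp: has_real_derivative_iff_has_vector_derivative[symmetric])
  ultimately have D1: "((\<lambda>y. \<Sum>n. d n * of_real (y powr \<nu>) ^ n) has_vector_derivative
      of_real (\<nu> * y powr (\<nu> - 1)) * (\<Sum>n. diffs d n * w ^ n)) (at y)"
    using field_vector_diff_chain_at[of "\<lambda>y. complex_of_real (y powr \<nu>)" _ y "\<lambda>w. \<Sum>n. d n * w ^ n"]
    by (simp add: w_def o_def)
  have D2: "((\<lambda>y. complex_of_real y powr s) has_vector_derivative (s * of_real y powr (s - 1))) (at y)"
    using y by (intro has_vector_derivative_real_field has_field_derivative_powr) auto
  have "s * of_real y powr (s - 1) * (\<Sum>n. d n * w ^ n) +
      of_real y powr s * (of_real (\<nu> * y powr (\<nu> - 1)) * (\<Sum>n. diffs d n * w ^ n)) =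
      of_real y powr (s - 1) * (s * (\<Sum>n. d n * w ^ n) + of_real \<nu> * (w * (\<Sum>n. diffs d n * w ^ n)))"
    using y by (simp add: w_def powr_diff field_simps)
  with has_vector_derivative_mult[OF D2 D1] T
  show "((\<lambda>y. of_real y powr s * (\<Sum>n. d n * of_real (y powr \<nu>) ^ n)) has_vector_derivative
      of_real y powr (s - 1) * (\<Sum>n. (s + of_nat n * of_real \<nu>) * d n * of_real (y powr \<nu>) ^ n)) (at y)"
    by (simp add: w_def sums_iff add_ac)
qed

text \<open>
  Each application multiplies the \<open>n\<close>-th coefficient by minus the current exponent and lowers all
  exponents by \<open>\<eta>\<close>. The formula must be known on an interval, not only at one point, since the
  next derivative depends on a neighbourhood.
\<close>

lemma weighted_deriv_funpow_power_series:
  fixes d :: "nat \<Rightarrow> complex" and s :: complex and \<nu> R \<eta> y :: real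
  assumes \<nu>: "0 < \<nu>"
    and d: "\<And>y. 0 < y \<Longrightarrow> y < R \<Longrightarrow> summable (\<lambda>n. d n * of_real (y powr \<nu>) ^ n)"
    and F: "\<And>y. 0 < y \<Longrightarrow> y < R \<Longrightarrow> F y = of_real y powr s * (\<Sum>n. d n * of_real (y powr \<nu>) ^ n)"
    and y: "0 < y" "y < R"
  defines "P j n \<equiv> (-1) ^ j * (\<Prod>i<j. s + of_nat n * of_real \<nu> - of_nat i * of_real \<eta>) * d n"
  shows "summable (\<lambda>n. P j n * of_real (y powr \<nu>) ^ n)"
    and "(weighted_deriv \<eta> ^^ j) F y = of_real y powr (s - of_nat j * of_real \<eta>) * (\<Sum>n. P j n * of_real (y powr \<nu>) ^ n)"
proof -
  have "summable (\<lambda>n. P j n * of_real (y powr \<nu>) ^ n) \<and>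
    (weighted_deriv \<eta> ^^ j) F y = of_real y powr (s - of_nat j * of_real \<eta>) * (\<Sum>n. P j n * of_real (y powr \<nu>) ^ n)"
    using y
  proof (induction j arbitrary: y)
    case 0
    then show ?case using d F by (simp add: P_def)
  next
    case (Suc j)
    define G where "G y = of_real y powr (s - of_nat j * of_real \<eta>) * (\<Sum>n. P j n * of_real (y powr \<nu>) ^ n)" for y
    define D where "D = (\<Sum>n. (s - of_nat j * of_real \<eta> + of_nat n * of_real \<nu>) * P j n * of_real (y powr \<nu>) ^ n)"
    note der = powr_power_series_has_vector_derivative[OF \<nu> Suc.prems, of "P j" "s - of_nat j * of_real \<eta>"]
    have P: "P (Suc j) n = - ((s - of_nat j * of_real \<eta> + of_nat n * of_real \<nu>) * P j n)" for n
      by (simp add: P_def algebra_simps)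
    have sum: "summable (\<lambda>n. (s - of_nat j * of_real \<eta> + of_nat n * of_real \<nu>) * P j n * of_real (y powr \<nu>) ^ n)"
      using Suc.IH by (intro der(1)) auto
    have "(G has_vector_derivative of_real y powr (s - of_nat j * of_real \<eta> - 1) * D) (at y)"
      unfolding G_def [abs_def] D_def using Suc.IH by (intro der(2)) auto
    then have "((weighted_deriv \<eta> ^^ j) F has_vector_derivative of_real y powr (s - of_nat j * of_real \<eta> - 1) * D) (at y)"
      by (rule has_vector_derivative_transform_within_open[where S = "{0<..<R}"])
         (use Suc in \<open>auto simp: G_def\<close>)
    then have "(weighted_deriv \<eta> ^^ Suc j) F y = - (of_real (y powr (1 - \<eta>)) * (of_real y powr (s - of_nat j * of_real \<eta> - 1) * D))"
      by (simp add: weighted_deriv_def vector_derivative_at)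
    also have "of_real (y powr (1 - \<eta>)) * (of_real y powr (s - of_nat j * of_real \<eta> - 1) * D) =
        of_real y powr (s - of_nat (Suc j) * of_real \<eta>) * D"
      using Suc.prems by (simp add: powr_def[of y] of_real_powr_eq_exp algebra_simps flip: exp_of_real exp_add)
    also have "- (of_real y powr (s - of_nat (Suc j) * of_real \<eta>) * D) =
        of_real y powr (s - of_nat (Suc j) * of_real \<eta>) * (\<Sum>n. P (Suc j) n * of_real (y powr \<nu>) ^ n)"
      by (simp add: D_def P suminf_minus[OF sum])
    finally show ?case using summable_minus[OF sum] by (simp add: P)
  qed
  then show "summable (\<lambda>n. P j n * of_real (y powr \<nu>) ^ n)"
    "(weighted_deriv \<eta> ^^ j) F y = of_real y powr (s - of_nat j * of_real \<eta>) * (\<Sum>n. P j n * of_real (y powr \<nu>) ^ n)"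
    by auto
qed

section \<open>Powers integrable at the origin\<close>

text \<open>
  If \<open>Re p \<le> -1\<close>, the integrand dominates a positive multiple of \<open>1 / t\<close> near \<open>0\<close>, and
  \<open>ln \<delta> - ln r\<close> is unbounded as \<open>r\<close> tends to \<open>0\<close>.
\<close>

lemma powr_integrable_near_0_imp_exponent_gt:
  fixes p L :: complex and h :: "real \<Rightarrow> complex"
  assumes x: "0 < x" and int: "set_integrable lborel {0<..<x} (\<lambda>t. of_real t powr p * h t)"
    and h: "(h \<longlongrightarrow> L) (at_right 0)" and L: "L \<noteq> 0"
  shows "- 1 < Re p"
proof (rule ccontr)
  assume "\<not> - 1 < Re p"
  then have p: "Re p \<le> - 1" by simp
  have "\<forall>\<^sub>F t in at_right 0. norm (h t) > norm L / 2"
    using L by (intro order_tendstoD(1)[OF tendsto_norm[OF h]]) simp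
  then obtain \<epsilon> where \<epsilon>: "0 < \<epsilon>" "\<And>t. 0 < t \<Longrightarrow> t < \<epsilon> \<Longrightarrow> norm L / 2 < norm (h t)"
    by (auto simp: eventually_at_right_field)
  define \<delta> where "\<delta> = Min {\<epsilon>, x, 1} / 2"
  have \<delta>: "0 < \<delta>" "\<delta> < \<epsilon>" "\<delta> < x" "\<delta> < 1" using \<epsilon> x by (auto simp: \<delta>_def min_def)
  define M where "M = (LINT t:{0<..<x}|lborel. norm (of_real t powr p * h t))"
  have bound: "norm L / 2 * (ln \<delta> - ln r) \<le> M" if r: "0 < r" "r < \<delta>" for r
  proof -
    have FTC: "((\<lambda>t. norm L / 2 * (1 / t)) has_integral norm L / 2 * ln \<delta> - norm L / 2 * ln r) {r..\<delta>}"
      using r by (intro fundamental_theorem_of_calculus)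
        (auto intro!: derivative_eq_intros simp: has_real_derivative_iff_has_vector_derivative[symmetric])
    have cont: "set_integrable lborel {r..\<delta>} (\<lambda>t. norm L / 2 * (1 / t))"
      using r by (intro borel_integrable_atLeastAtMost' continuous_intros) auto
    have "norm L / 2 * (ln \<delta> - ln r) = (LINT t:{r..\<delta>}|lborel. norm L / 2 * (1 / t))"
      using set_borel_integral_eq_integral(2)[OF cont] FTC by (simp add: integral_unique algebra_simps)
    also have "\<dots> \<le> M"
      unfolding M_def set_lebesgue_integral_def
    proof (rule integral_mono)
      show "integrable lborel (\<lambda>t. indicator {r..\<delta>} t *\<^sub>R (norm L / 2 * (1 / t)))"
        using cont by (simp add: set_integrable_def)
      show "integrable lborel (\<lambda>t. indicator {0<..<x} t *\<^sub>R norm (of_real t powr p * h t))"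
        using set_integrable_norm[OF int] by (simp add: set_integrable_def)
      fix t :: real
      show "indicator {r..\<delta>} t *\<^sub>R (norm L / 2 * (1 / t)) \<le> indicator {0<..<x} t *\<^sub>R norm (of_real t powr p * h t)"
      proof (cases "t \<in> {r..\<delta>}")
        case True
        have "1 / t = t powr (- 1)" using True r by (simp add: powr_minus field_simps)
        also have "\<dots> \<le> t powr Re p" using True r \<delta> p by (intro powr_mono') auto
        finally have "norm L / 2 * (1 / t) \<le> norm (h t) * t powr Re p"
          using \<epsilon>(2)[of t] True r \<delta> by (intro mult_mono) auto
        with True r \<delta> show ?thesis by (simp add: norm_mult norm_powr_real_powr mult_ac)
      qed (auto simp: indicator_def)
    qed
    finally show ?thesis .
  qed
  have "0 \<le> M" unfolding M_def set_lebesgue_integral_def by (intro integral_nonneg_AE AE_I2) auto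
  \<comment> \<open>chosen so that the lower bound for the integral equals \<open>M + 1\<close>\<close>
  define r where "r = \<delta> * exp (- ((M + 1) / (norm L / 2)))"
  have "r < \<delta> * 1" unfolding r_def using \<delta> L \<open>0 \<le> M\<close> by (intro mult_strict_left_mono) auto
  moreover have "0 < r" using \<delta> by (simp add: r_def)
  moreover have "ln \<delta> - ln r = (M + 1) / (norm L / 2)" using \<delta> by (simp add: r_def ln_mult)
  ultimately have "norm L / 2 * ((M + 1) / (norm L / 2)) \<le> M" using bound[of r] by simp
  then show False using L by simp
qed

section \<open>The kernel of the fractional derivative\<close>

lemma of_real_minus_powr:
  assumes "0 < r"
  shows "complex_of_real (- r) powr c = exp (\<i> * of_real pi * c) * of_real r powr c"
  using assms Ln_minus[of "complex_of_real r"]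
  by (simp add: powr_def Ln_of_real algebra_simps flip: exp_add)

text \<open>
  For \<open>t < y\<close> the base of the power in the kernel is negative. Pulling the phase
  \<open>exp (i\<pi>c)\<close> of the principal branch, for the exponent \<open>c = \<sigma> - frac_order \<sigma> + 1\<close>, out leaves a power of the positive number
  \<open>y powr \<eta> - t powr \<eta>\<close>; written with exponent \<open>b - 1\<close> for \<open>b = frac_order \<sigma> - \<sigma>\<close> it is a Beta integrand.
\<close>

lemma frac_kernel_eq:
  assumes "0 < \<eta>" "0 < t" "t < y"
  shows "frac_kernel \<eta> \<sigma> f y t = exp (- \<i> * of_real pi * (\<sigma> - of_nat (frac_order \<sigma>) + 1)) *
     (of_real (t powr (\<eta> - 1)) * f t * of_real (y powr \<eta> - t powr \<eta>) powr (of_nat (frac_order \<sigma>) - \<sigma> - 1))"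
proof -
  define c where "c = \<sigma> - of_nat (frac_order \<sigma>) + 1"
  have "t powr \<eta> < y powr \<eta>" using assms by (intro powr_less_mono2) auto
  then have "complex_of_real (t powr \<eta> - y powr \<eta>) powr c =
      exp (\<i> * of_real pi * c) * of_real (y powr \<eta> - t powr \<eta>) powr c"
    using of_real_minus_powr[of "y powr \<eta> - t powr \<eta>" c] by simp
  then have "frac_kernel \<eta> \<sigma> f y t = exp (- (\<i> * of_real pi * c)) *
     (of_real (t powr (\<eta> - 1)) * f t * of_real (y powr \<eta> - t powr \<eta>) powr (- c))"
    unfolding frac_kernel_def c_def [symmetric] by (simp add: powr_minus exp_minus divide_inverse mult_ac)
  then show ?thesis by (simp add: c_def algebra_simps)
qed

lemma frac_integral_eq:
  assumes "0 < \<eta>" "0 < y"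
  shows "frac_integral \<eta> \<sigma> f y = - exp (- \<i> * of_real pi * (\<sigma> - of_nat (frac_order \<sigma>) + 1)) *
     (LINT t:{0<..<y}|lborel. of_real (t powr (\<eta> - 1)) * f t *
        of_real (y powr \<eta> - t powr \<eta>) powr (of_nat (frac_order \<sigma>) - \<sigma> - 1))"
proof -
  have "frac_integral \<eta> \<sigma> f y = - (LINT t:{0<..<y}|lborel. frac_kernel \<eta> \<sigma> f y t)"
    using assms by (simp add: frac_integral_def interval_lebesgue_integral_def zero_ereal_def)
  also have "(LINT t:{0<..<y}|lborel. frac_kernel \<eta> \<sigma> f y t) =
      (LINT t:{0<..<y}|lborel. exp (- \<i> * of_real pi * (\<sigma> - of_nat (frac_order \<sigma>) + 1)) *
        (of_real (t powr (\<eta> - 1)) * f t *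
        of_real (y powr \<eta> - t powr \<eta>) powr (of_nat (frac_order \<sigma>) - \<sigma> - 1)))"
    using assms by (intro set_lebesgue_integral_cong) (auto simp: frac_kernel_eq)
  finally show ?thesis by (simp only: set_integral_mult_right) simp
qed

text \<open>
  After splitting off \<open>t\<close> to the power \<open>\<mu> + \<eta> - 1\<close>, the rest of the kernel has a nonzero limit at the
  origin, because the series tends to its constant coefficient. So absolute integrability of the kernel
  is what guarantees convergence of the Beta integrals of all terms.
\<close>

lemma frac_kernel_integrable_imp_exponent_gt:
  fixes c :: "nat \<Rightarrow> complex" and \<mu> :: complex and \<nu> \<eta> y :: real
  assumes \<eta>: "0 < \<eta>" and y: "0 < y" and \<nu>: "0 < \<nu>"
    and c: "summable (\<lambda>n. c n * of_real (y powr \<nu>) ^ n)" and c0: "c 0 \<noteq> 0"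
    and int: "interval_lebesgue_integrable lborel (ereal y) 0
      (frac_kernel \<eta> \<sigma> (\<lambda>t. of_real t powr \<mu> * (\<Sum>n. c n * of_real (t powr \<nu>) ^ n)) y)"
  shows "0 < Re (\<mu> / \<eta> + 1)"
proof -
  define E where "E t = (\<Sum>n. c n * complex_of_real (t powr \<nu>) ^ n)" for t
  define b where "b = of_nat (frac_order \<sigma>) - \<sigma>"
  define \<epsilon> where "\<epsilon> = exp (- \<i> * of_real pi * (\<sigma> - of_nat (frac_order \<sigma>) + 1))"
  define h where "h t = \<epsilon> * (E t * of_real (y powr \<eta> - t powr \<eta>) powr (b - 1))" for t
  have "set_integrable lborel {0<..<y} (frac_kernel \<eta> \<sigma> (\<lambda>t. of_real t powr \<mu> * E t) y)"
    using int y by (simp add: interval_lebesgue_integrable_def zero_ereal_def E_def)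
  then have "set_integrable lborel {0<..<y} (\<lambda>t. of_real t powr (\<mu> + \<eta> - 1) * h t)"
  proof (rule set_integrable_cong[THEN iffD1, rotated -1])
    fix t assume t: "t \<in> {0<..<y}"
    then have "complex_of_real (t powr (\<eta> - 1)) * of_real t powr \<mu> = of_real t powr (\<mu> + \<eta> - 1)"
      by (simp add: powr_def[of t] of_real_powr_eq_exp algebra_simps flip: exp_of_real exp_add)
    with t \<eta> show "frac_kernel \<eta> \<sigma> (\<lambda>t. of_real t powr \<mu> * E t) y t = of_real t powr (\<mu> + \<eta> - 1) * h t"
      by (simp add: frac_kernel_eq h_def b_def \<epsilon>_def mult_ac)
  qed auto
  moreover have "(h \<longlongrightarrow> \<epsilon> * (c 0 * of_real (y powr \<eta>) powr (b - 1))) (at_right 0)"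
  proof -
    have 0: "((\<lambda>t. t powr r) \<longlongrightarrow> 0) (at_right 0)" if "0 < r" for r :: real
      by (rule tendsto_zero_powrI[OF _ tendsto_const _ that])
         (auto simp: eventually_at_right_less eventually_at_topological intro!: tendsto_eq_intros)
    have "isCont (\<lambda>w. \<Sum>n. c n * w ^ n) 0"
      using y by (intro isCont_powser[OF c]) simp
    then have "((\<lambda>t. \<Sum>n. c n * of_real (t powr \<nu>) ^ n) \<longlongrightarrow> (\<Sum>n. c n * 0 ^ n)) (at_right 0)"
      by (rule isCont_tendsto_compose) (use tendsto_of_real[OF 0[OF \<nu>]] in simp)
    then have "(E \<longlongrightarrow> c 0) (at_right 0)"
      by (simp add: E_def [abs_def])
    moreover have "((\<lambda>t. complex_of_real (y powr \<eta> - t powr \<eta>) powr (b - 1)) \<longlongrightarrow> of_real (y powr \<eta>) powr (b - 1)) (at_right 0)"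
    proof (rule tendsto_powr_complex)
      show "((\<lambda>t. complex_of_real (y powr \<eta> - t powr \<eta>)) \<longlongrightarrow> of_real (y powr \<eta>)) (at_right 0)"
        using tendsto_diff[OF tendsto_const[of "y powr \<eta>"] 0[OF \<eta>]] by (intro tendsto_of_real) simp
    qed (use y in auto)
    ultimately show ?thesis
      unfolding h_def [abs_def] by (intro tendsto_mult tendsto_const)
  qed
  moreover have "\<epsilon> * (c 0 * of_real (y powr \<eta>) powr (b - 1)) \<noteq> 0"
    using c0 y by (simp add: \<epsilon>_def)
  ultimately have "- 1 < Re (\<mu> + \<eta> - 1)"
    using y by (intro powr_integrable_near_0_imp_exponent_gt)
  with \<eta> show ?thesis by (simp add: field_simps)
qed

section \<open>Termwise fractional differentiation\<close>

lemma prod_descending_eq_pochhammer: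
  "(\<Prod>i<m. z + of_nat m - 1 - of_nat i) = pochhammer (z :: complex) m"
proof -
  have "(\<Prod>i<m. z + of_nat m - 1 - of_nat i) = (\<Prod>i<m. z + of_nat (m - Suc i))"
    by (intro prod.cong) (auto simp: of_nat_diff)
  also have "\<dots> = (\<Prod>i<m. z + of_nat i)"
    by (rule prod.nat_diff_reindex)
  finally show ?thesis by (simp add: pochhammer_prod atLeast0LessThan)
qed

text \<open>
  Integration produces the coefficient \<open>\<Gamma>(a\<^sub>n) \<Gamma>(N - \<sigma>) / \<Gamma>(a\<^sub>n - \<sigma> + N)\<close>, where \<open>N\<close> is the
  order, and the \<open>N\<close> weighted derivatives the factor \<open>(-\<eta>)\<^bsup>N\<^esup> (a\<^sub>n - \<sigma>)\<^sub>N\<close>. By the functional equation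
  of the entire function \<open>1/\<Gamma>\<close> only \<open>\<Gamma>(a\<^sub>n) / \<Gamma>(a\<^sub>n - \<sigma>)\<close> remains, also where \<open>a\<^sub>n - \<sigma>\<close> is a pole of \<open>\<Gamma>\<close>.
\<close>

lemma frac_deriv_power_series:
  fixes c :: "nat \<Rightarrow> complex" and \<mu> \<sigma> :: complex and \<nu> \<eta> R x :: real
  defines "a \<equiv> \<lambda>n. \<mu> / \<eta> + 1 + of_real (\<nu> / \<eta>) * of_nat n"
  assumes \<eta>: "0 < \<eta>" and \<nu>: "0 < \<nu>" and \<sigma>: "0 < Re \<sigma>" and x: "0 < x" "x < R" and \<mu>: "0 < Re (\<mu> / \<eta> + 1)"
    and c: "\<And>y. 0 < y \<Longrightarrow> y < R \<Longrightarrow> summable (\<lambda>n. c n * of_real (y powr \<nu>) ^ n)"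
  shows "(\<lambda>n. exp (- \<i> * of_real pi * \<sigma>) * of_real \<eta> powr \<sigma> * of_real x powr (\<mu> - \<sigma> * \<eta>) *
      (c n * Gamma (a n) / Gamma (a n - \<sigma>) * of_real (x powr \<nu>) ^ n))
    sums frac_deriv \<eta> \<sigma> (\<lambda>t. of_real t powr \<mu> * (\<Sum>n. c n * of_real (t powr \<nu>) ^ n)) x"
proof -
  define f where "f t = complex_of_real t powr \<mu> * (\<Sum>n. c n * of_real (t powr \<nu>) ^ n)" for t
  define N where "N = frac_order \<sigma>"
  define b where "b = of_nat N - \<sigma>"
  define \<epsilon> where "\<epsilon> = exp (- \<i> * of_real pi * (\<sigma> - of_nat N + 1))"
  define d where "d n = - \<epsilon> / \<eta> * (c n * Beta (a n) b)" for n
  define s where "s = \<mu> + \<eta> * b"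
  define P where "P n = (-1) ^ N * (\<Prod>i<N. s + of_nat n * of_real \<nu> - of_nat i * of_real \<eta>) * d n" for n
  have b: "0 < Re b"
    using \<sigma> by (simp add: b_def N_def frac_order_def) linarith
  have a_eq: "(\<mu> + of_nat n * of_real \<nu>) / \<eta> + 1 = a n" for n
    using \<eta> by (simp add: a_def field_simps)
  have absc: "summable (\<lambda>n. norm (c n) * (y powr \<nu>) ^ n)" if y: "0 < y" "y < R" for y
  proof -
    have "summable (\<lambda>n. norm (c n * complex_of_real (y powr \<nu>) ^ n))"
    proof (rule powser_insidea)
      show "summable (\<lambda>n. c n * complex_of_real (((y + R) / 2) powr \<nu>) ^ n)" using y by (intro c) auto
      show "norm (complex_of_real (y powr \<nu>)) < norm (complex_of_real (((y + R) / 2) powr \<nu>))"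
        using y \<nu> by (simp add: powr_less_mono2)
    qed
    then show ?thesis by (simp add: norm_mult norm_power)
  qed
  have F: "(\<lambda>n. d n * of_real (y powr \<nu>) ^ n) sums (frac_integral \<eta> \<sigma> f y / of_real y powr s)"
    if y: "0 < y" "y < R" for y
  proof -
    have "of_real y powr s \<noteq> (0 :: complex)" using y by simp
    then show ?thesis
      using sums_mult[OF Beta_integral_power_series[OF y(1) \<eta> \<nu> \<mu> b absc[OF y], folded s_def], of "- \<epsilon> / of_real y powr s"] y \<eta>
      by (simp add: frac_integral_eq f_def a_eq d_def \<epsilon>_def b_def N_def mult_ac)
  qed
  have sum: "summable (\<lambda>n. P n * of_real (x powr \<nu>) ^ n)"
    unfolding P_def using F
    by (intro weighted_deriv_funpow_power_series(1)[OF \<nu> _ _ x, where F = "\<lambda>y. of_real y powr s * (\<Sum>n. d n * of_real (y powr \<nu>) ^ n)"])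
       (auto simp: sums_iff)
  have "(weighted_deriv \<eta> ^^ N) (frac_integral \<eta> \<sigma> f) x =
      of_real x powr (s - of_nat N * of_real \<eta>) * (\<Sum>n. P n * of_real (x powr \<nu>) ^ n)"
    unfolding P_def using F by (intro weighted_deriv_funpow_power_series(2)[OF \<nu> _ _ x]) (auto simp: sums_iff)
  then have "frac_deriv \<eta> \<sigma> f x = of_real \<eta> powr (1 - b) / Gamma b *
      (of_real x powr (\<mu> - \<sigma> * \<eta>) * (\<Sum>n. P n * of_real (x powr \<nu>) ^ n))"
    by (simp add: frac_deriv_def b_def N_def s_def algebra_simps)
  then have main: "(\<lambda>n. of_real \<eta> powr (1 - b) / Gamma b * (of_real x powr (\<mu> - \<sigma> * \<eta>) * (P n * of_real (x powr \<nu>) ^ n)))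
      sums frac_deriv \<eta> \<sigma> f x"
    by (simp only:) (intro sums_mult summable_sums sum)
  have P: "of_real \<eta> powr (1 - b) / Gamma b * P n =
      exp (- \<i> * of_real pi * \<sigma>) * of_real \<eta> powr \<sigma> * (c n * Gamma (a n) / Gamma (a n - \<sigma>))" for n
  proof -
    have "s + of_nat n * of_real \<nu> - of_nat i * of_real \<eta> = \<eta> * (a n - \<sigma> + of_nat N - 1 - of_nat i)" for i
      using \<eta> by (simp add: s_def a_def b_def field_simps)
    then have prod: "(\<Prod>i<N. s + of_nat n * of_real \<nu> - of_nat i * of_real \<eta>) = of_real \<eta> ^ N * pochhammer (a n - \<sigma>) N"
      by (simp add: prod.distrib prod_descending_eq_pochhammer)
    have "Gamma b \<noteq> 0" using b by (rule Gamma_neq_0_if_Re_pos)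
    then have "pochhammer (a n - \<sigma>) N * Beta (a n) b / Gamma b = Gamma (a n) * (pochhammer (a n - \<sigma>) N * rGamma (a n - \<sigma> + of_nat N))"
      by (simp add: Beta_altdef b_def algebra_simps)
    also have "\<dots> = Gamma (a n) / Gamma (a n - \<sigma>)"
      by (simp only: pochhammer_rGamma [symmetric]) (simp add: rGamma_inverse_Gamma divide_inverse)
    finally have 1: "pochhammer (a n - \<sigma>) N * Beta (a n) b / Gamma b = Gamma (a n) / Gamma (a n - \<sigma>)" .
    \<comment> \<open>the power of \<open>\<eta>\<close>: prefactor, \<open>N\<close> derivatives, and the Jacobian \<open>1 / \<eta>\<close>\<close>
    have 2: "of_real \<eta> powr (1 - b) * of_real \<eta> ^ N / of_real \<eta> = complex_of_real \<eta> powr \<sigma>"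
    proof -
      have "complex_of_real \<eta> ^ N = of_real \<eta> powr of_nat N"
        using \<eta> by (simp add: powr_nat')
      then have "of_real \<eta> powr (1 - b) * of_real \<eta> ^ N = complex_of_real \<eta> powr (\<sigma> + 1)"
        by (simp only: powr_add [symmetric]) (simp add: b_def add.commute)
      then show ?thesis using \<eta> by (simp add: powr_add)
    qed
    \<comment> \<open>the sign: orientation of the integral, \<open>N\<close> weighted derivatives, and the phase of the kernel\<close>
    have "exp (\<i> * of_real pi * of_nat N) = (-1 :: complex) ^ N"
      by (simp add: exp_of_nat2_mult mult.assoc[symmetric])
    then have 3: "- ((-1) ^ N * \<epsilon>) = exp (- \<i> * of_real pi * \<sigma>)"
      by (simp add: \<epsilon>_def algebra_simps exp_diff exp_add exp_minus inverse_eq_divide)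
    have "of_real \<eta> powr (1 - b) / Gamma b * P n =
        (- ((-1) ^ N * \<epsilon>)) * (of_real \<eta> powr (1 - b) * of_real \<eta> ^ N / of_real \<eta>) *
        (c n * (pochhammer (a n - \<sigma>) N * Beta (a n) b / Gamma b))"
      by (simp add: P_def d_def prod mult_ac)
    also have "\<dots> = exp (- \<i> * of_real pi * \<sigma>) * of_real \<eta> powr \<sigma> * (c n * (Gamma (a n) / Gamma (a n - \<sigma>)))"
      by (simp only: 1 2 3)
    finally show ?thesis by simp
  qed
  have "of_real \<eta> powr (1 - b) / Gamma b * (of_real x powr (\<mu> - \<sigma> * \<eta>) * (P n * of_real (x powr \<nu>) ^ n)) =
      exp (- \<i> * of_real pi * \<sigma>) * of_real \<eta> powr \<sigma> * of_real x powr (\<mu> - \<sigma> * \<eta>) *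
      (c n * Gamma (a n) / Gamma (a n - \<sigma>) * of_real (x powr \<nu>) ^ n)" for n
    using arg_cong[OF P[of n], of "\<lambda>z. z * (of_real x powr (\<mu> - \<sigma> * \<eta>) * of_real (x powr \<nu>) ^ n)"]
    by (simp only: mult_ac times_divide_eq_right times_divide_eq_left)
  with main show ?thesis by (simp only: f_def [abs_def])
qed

section \<open>The k-Mittag-Leffler function\<close>

lemma k_mittag_leffler_term_eq:
  "k_mittag_leffler_term \<theta> q k \<xi> \<zeta> z n = k_mittag_leffler_term \<theta> q k \<xi> \<zeta> 1 n * z ^ n"
  by (simp add: k_mittag_leffler_term_def)

text \<open>
  Since \<open>\<xi> / k\<close> is real, the powers of \<open>k\<close> in the k-Pochhammer symbol and the k-Gamma function combine
  into the factor \<open>k powr (1 - \<zeta> / k)\<close> and a geometric factor that only rescales the argument.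
\<close>

lemma k_mittag_leffler_term_gamma:
  assumes k: "0 < k" and r: "\<xi> / of_real k = of_real r"
  shows "k_mittag_leffler_term \<theta> q k \<xi> \<zeta> z n =
    of_real k powr (1 - \<zeta> / of_real k) / Gamma (\<theta> / of_real k) *
    (Gamma (\<theta> / of_real k + of_real q * of_nat n) / Gamma (\<zeta> / of_real k + of_real r * of_nat n) *
      (of_real k powr (of_real q - of_real r) * z) ^ n / fact n)"
proof -
  have \<xi>: "\<xi> = of_real r * of_real k" using r k by (simp add: field_simps)
  have arg: "(of_nat n * \<xi> + \<zeta>) / of_real k = \<zeta> / of_real k + of_real r * of_nat n"
    using k by (simp add: \<xi> field_simps)
  have "complex_of_real k powr (of_real (of_nat n * q)) / of_real k powr (\<zeta> / of_real k + of_real r * of_nat n - 1) =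
      of_real k powr (1 - \<zeta> / of_real k) * (of_real k powr (of_real q - of_real r)) ^ n"
    using k by (simp add: of_real_powr_eq_exp algebra_simps flip: exp_of_nat_mult exp_add exp_diff)
  then show ?thesis
    unfolding k_mittag_leffler_term_def k_pochhammer_def gen_pochhammer_def k_Gamma_def arg
    by (simp add: divide_simps power_mult_distrib mult_ac)
qed

theorem theorem2:
  fixes x \<eta> \<nu> k q :: real and \<sigma> \<mu> \<xi> \<zeta> \<theta> :: complex
  assumes "0 < x" and "0 < q" and "0 < \<eta>"
    and "0 < Re \<sigma>" and "0 < Re \<xi>" and "0 < Re \<zeta>" and "0 < Re \<theta>"
    and "\<xi> / of_real k \<in> \<real>" and "0 < Re (\<xi> / of_real k)"
    and "0 < \<nu> / \<eta>"
    and "0 \<le> 1 + Re (\<xi> / of_real k) - q"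
    and "frac_deriv_defined \<eta> \<sigma>
           {t. 0 < t \<and> summable (k_mittag_leffler_term \<theta> q k \<xi> \<zeta> (of_real (t powr \<nu>)))}
           (\<lambda>t. of_real t powr \<mu> * k_mittag_leffler \<theta> q k \<xi> \<zeta> (of_real (t powr \<nu>))) x"
    and "fox_wright_converges
           [(\<theta> / of_real k, q), (\<mu> / of_real \<eta> + 1, \<nu> / \<eta>)]
           [(\<zeta> / of_real k, Re (\<xi> / of_real k)), (\<mu> / of_real \<eta> - \<sigma> + 1, \<nu> / \<eta>)]
           (of_real k powr (of_real q - \<xi> / of_real k) * of_real (x powr \<nu>))"
  shows "frac_deriv \<eta> \<sigma>
           (\<lambda>t. of_real t powr \<mu> * k_mittag_leffler \<theta> q k \<xi> \<zeta> (of_real (t powr \<nu>))) x =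
         (- 1) powr (- \<sigma>) * of_real x powr (\<mu> - \<sigma> * of_real \<eta>) *
         (of_real \<eta> powr \<sigma> / Gamma (\<theta> / of_real k)) * of_real k powr (1 - \<zeta> / of_real k) *
         fox_wright
           [(\<theta> / of_real k, q), (\<mu> / of_real \<eta> + 1, \<nu> / \<eta>)]
           [(\<zeta> / of_real k, Re (\<xi> / of_real k)), (\<mu> / of_real \<eta> - \<sigma> + 1, \<nu> / \<eta>)]
           (of_real k powr (of_real q - \<xi> / of_real k) * of_real (x powr \<nu>))"
proof -
  define r where "r = Re (\<xi> / of_real k)"
  have r: "\<xi> / of_real k = of_real r"
    using assms(8) by (simp add: r_def complex_is_Real_iff complex_eq_iff)
  have k: "0 < k"
    using assms(5,9) by (simp add: zero_less_divide_iff)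
  have \<nu>: "0 < \<nu>" using assms(3,10) by (simp add: zero_less_divide_iff)
  define c where "c = k_mittag_leffler_term \<theta> q k \<xi> \<zeta> 1"
  define f where "f t = complex_of_real t powr \<mu> * (\<Sum>n. c n * of_real (t powr \<nu>) ^ n)" for t
  have f: "(\<lambda>t. of_real t powr \<mu> * k_mittag_leffler \<theta> q k \<xi> \<zeta> (of_real (t powr \<nu>))) = f"
    by (simp add: fun_eq_iff f_def c_def k_mittag_leffler_def flip: k_mittag_leffler_term_eq)
  note defined = assms(12) [unfolded f frac_deriv_defined_def]
  obtain R where R: "x < R" "{0<..<R} \<subseteq> {t. 0 < t \<and> summable (k_mittag_leffler_term \<theta> q k \<xi> \<zeta> (of_real (t powr \<nu>)))}"
    using defined by blast
  have c: "summable (\<lambda>n. c n * of_real (y powr \<nu>) ^ n)" if "0 < y" "y < R" for y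
    using R(2) that by (auto simp: c_def simp flip: k_mittag_leffler_term_eq)
  have "Gamma (\<theta> / of_real k) \<noteq> 0" "Gamma (\<zeta> / of_real k) \<noteq> 0"
    using assms k by (auto intro!: Gamma_neq_0_if_Re_pos)
  \<comment> \<open>the limit of the Mittag-Leffler series at the origin, which decides integrability there\<close>
  then have c0: "c 0 \<noteq> 0"
    using k by (simp add: c_def k_mittag_leffler_term_gamma[OF k r])
  have "interval_lebesgue_integrable lborel (ereal x) 0 (frac_kernel \<eta> \<sigma> f x)"
    using defined eventually_nhds_x_imp_x by blast
  then have \<mu>: "0 < Re (\<mu> / \<eta> + 1)"
    unfolding f_def by (intro frac_kernel_integrable_imp_exponent_gt[OF assms(3,1) \<nu> c[OF assms(1) R(1)] c0])
  let ?as = "[(\<theta> / of_real k, q), (\<mu> / of_real \<eta> + 1, \<nu> / \<eta>)]"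
  let ?bs = "[(\<zeta> / of_real k, r), (\<mu> / of_real \<eta> - \<sigma> + 1, \<nu> / \<eta>)]"
  let ?z = "of_real k powr (of_real q - of_real r) * of_real (x powr \<nu>)"
  define C where "C = (- 1) powr (- \<sigma>) * of_real x powr (\<mu> - \<sigma> * of_real \<eta>) *
         (of_real \<eta> powr \<sigma> / Gamma (\<theta> / of_real k)) * of_real k powr (1 - \<zeta> / of_real k)"
  have "(-1) powr (- \<sigma>) = exp (- \<i> * of_real pi * \<sigma>)"
    using of_real_minus_powr[of 1 "- \<sigma>"] by simp
  then have term_eq: "exp (- \<i> * of_real pi * \<sigma>) * of_real \<eta> powr \<sigma> * of_real x powr (\<mu> - \<sigma> * \<eta>) *
      (c n * Gamma (\<mu> / \<eta> + 1 + of_real (\<nu> / \<eta>) * of_nat n) / Gamma (\<mu> / \<eta> + 1 + of_real (\<nu> / \<eta>) * of_nat n - \<sigma>) * of_real (x powr \<nu>) ^ n) =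
      C * fox_wright_term ?as ?bs ?z n" for n
    by (simp add: C_def c_def k_mittag_leffler_term_gamma[OF k r] fox_wright_term_def power_mult_distrib algebra_simps)
  have "(\<lambda>n. C * fox_wright_term ?as ?bs ?z n) sums frac_deriv \<eta> \<sigma> f x"
    using frac_deriv_power_series[OF assms(3) \<nu> assms(4,1) R(1) \<mu> c] unfolding term_eq f_def .
  moreover have "(\<lambda>n. C * fox_wright_term ?as ?bs ?z n) sums (C * fox_wright ?as ?bs ?z)"
    unfolding fox_wright_def using assms(13)
    by (intro sums_mult summable_sums) (simp add: fox_wright_converges_def r flip: r_def)
  ultimately have "frac_deriv \<eta> \<sigma> f x = C * fox_wright ?as ?bs ?z"
    by (rule sums_unique2)
  then show ?thesis unfolding f r C_def by simp
qed

end
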